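(* Let $f:\mathbb{C}\to\mathbb{C}$ be the holomorphic function $f(z)=\sin(e^{z})$ and let $\Sigma=\{(z,f(z)) : z\in\mathbb{C}\}\subset\mathbb{C}^2=\mathbb{R}^4$ be its graph. Then $\Sigma$ is a smooth stable minimal surface in $\mathbb{R}^4=\mathbb{C}^2$, and there exist constants $c>0$ and $r_0>0$ such that for all $r\ge r_0$, $$\operatorname{Area}(B_r\cap\Sigma)\ge e^{c\,r}.$$
   Context: $\mathbb{C}^2$ is identified with Euclidean $\mathbb{R}^4$. $B_r$ denotes the Euclidean ball of radius $r$ centered at the origin in $\mathbb{R}^4$, and $\operatorname{Area}$ is the two-dimensional area of the surface induced by the Euclidean metric. A minimal surface is stable if the second variation of area is nonnegative for all compactly supported variations. *)

theory Defs
  imports "HOL-Analysis.Analysis"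
begin

text \<open>
  \<open>C_k_on k f S\<close>: \<open>f\<close> is of class \<open>C\<^sup>k\<close> on \<open>S\<close>. Derivatives are
  unrestricted (\<open>at x\<close>), so this is meant for open \<open>S\<close> only.
\<close>

primrec C_k_on ::
  "nat \<Rightarrow> ('a::euclidean_space \<Rightarrow> 'b::euclidean_space) \<Rightarrow> 'a set \<Rightarrow> bool" where
  "C_k_on 0 f S \<longleftrightarrow> continuous_on S f"
| "C_k_on (Suc k) f S \<longleftrightarrow>
     (\<forall>x\<in>S. f differentiable (at x)) \<and>
     (\<forall>v. C_k_on k (\<lambda>x. frechet_derivative f (at x) v) S)"

definition smooth_on ::
  "'a set \<Rightarrow> ('a::euclidean_space \<Rightarrow> 'b::euclidean_space) \<Rightarrow> bool" where
  "smooth_on S f \<longleftrightarrow> (\<forall>k. C_k_on k f S)"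

text \<open>
  The surfaces considered here are embedded planes: they carry one global chart, with parameter
  domain the whole plane \<open>\<real>\<^sup>2\<close>, written as the type \<^typ>\<open>complex\<close> (real
  basis \<open>1\<close>, \<open>\<i>\<close>). The ambient Euclidean space is arbitrary.
\<close>

definition parametrizes_smooth_surface ::
  "(complex \<Rightarrow> 'a::euclidean_space) \<Rightarrow> 'a set \<Rightarrow> bool" where
  "parametrizes_smooth_surface X S \<longleftrightarrow>
     smooth_on UNIV X \<and>
     (\<forall>z. inj (frechet_derivative X (at z))) \<and>
     (\<exists>Y. homeomorphism UNIV S X Y)"

text \<open>
  Square root of the determinant of the first fundamental form, i.e. of the metric induced from
  the ambient space, in the coordinates \<open>z = x + \<i> y\<close>.
\<close>

definition area_density :: "(complex \<Rightarrow> 'a::euclidean_space) \<Rightarrow> complex \<Rightarrow> real" where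
  "area_density X z =
     (let Xx = frechet_derivative X (at z) 1;
          Xy = frechet_derivative X (at z) \<i>
      in sqrt ((Xx \<bullet> Xx) * (Xy \<bullet> Xy) - (Xx \<bullet> Xy)\<^sup>2))"

text \<open>
  Riemannian area of the piece of \<open>X\<close> over the parameter region \<open>D\<close>. For injective \<open>X\<close> the area
  of a subset \<open>A\<close> of the surface \<open>range X\<close> is \<open>area_over X (X -` A)\<close>.
\<close>

definition area_over :: "(complex \<Rightarrow> 'a::euclidean_space) \<Rightarrow> complex set \<Rightarrow> ennreal" where
  "area_over X D = (\<integral>\<^sup>+z\<in>D. ennreal (area_density X z) \<partial>lborel)"

text \<open>
  A smooth family \<open>H t\<close>, \<open>\<bar>t\<bar> < \<epsilon>\<close>, of maps of the surface into the ambient space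
  that starts at \<open>X\<close> and does not move points outside the compact set \<open>K\<close>. It is not required to
  be normal, nor affine in \<open>t\<close>.
\<close>

definition compactly_supported_variation ::
  "(complex \<Rightarrow> 'a::euclidean_space) \<Rightarrow> real \<Rightarrow> complex set \<Rightarrow> (real \<Rightarrow> complex \<Rightarrow> 'a) \<Rightarrow> bool" where
  "compactly_supported_variation X \<epsilon> K H \<longleftrightarrow>
     0 < \<epsilon> \<and> compact K \<and>
     smooth_on ({-\<epsilon><..<\<epsilon>} \<times> UNIV) (\<lambda>(t, z). H t z) \<and>
     (\<forall>z. H 0 z = X z) \<and>
     (\<forall>t z. \<bar>t\<bar> < \<epsilon> \<longrightarrow> z \<notin> K \<longrightarrow> H t z = X z)"

text \<open>
  Only the area over \<open>K\<close> changes along the variation, and it is finite for small \<open>t\<close>, so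
  the \<open>t\<close>-derivatives below are those of the area of the varied surface.
\<close>

definition varied_area :: "(real \<Rightarrow> complex \<Rightarrow> 'a::euclidean_space) \<Rightarrow> complex set \<Rightarrow> real \<Rightarrow> real" where
  "varied_area H K t = enn2real (area_over (H t) K)"

definition has_first_variation ::
  "(real \<Rightarrow> complex \<Rightarrow> 'a::euclidean_space) \<Rightarrow> complex set \<Rightarrow> real \<Rightarrow> bool" where
  "has_first_variation H K v \<longleftrightarrow> (varied_area H K has_real_derivative v) (at 0)"

definition has_second_variation ::
  "(real \<Rightarrow> complex \<Rightarrow> 'a::euclidean_space) \<Rightarrow> complex set \<Rightarrow> real \<Rightarrow> bool" where
  "has_second_variation H K v \<longleftrightarrow>
     (\<exists>A'. (\<forall>\<^sub>F t in nhds 0. (varied_area H K has_real_derivative A' t) (at t)) \<and>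
           (A' has_real_derivative v) (at 0))"

definition minimal_surface :: "(complex \<Rightarrow> 'a::euclidean_space) \<Rightarrow> 'a set \<Rightarrow> bool" where
  "minimal_surface X S \<longleftrightarrow>
     parametrizes_smooth_surface X S \<and>
     (\<forall>\<epsilon> K H. compactly_supported_variation X \<epsilon> K H \<longrightarrow> has_first_variation H K 0)"

text \<open>
  Existence of the second derivative is part of the condition, so no default value of a
  derivative operator can satisfy it.
\<close>

definition stable_minimal_surface :: "(complex \<Rightarrow> 'a::euclidean_space) \<Rightarrow> 'a set \<Rightarrow> bool" where
  "stable_minimal_surface X S \<longleftrightarrow>
     minimal_surface X S \<and>
     (\<forall>\<epsilon> K H. compactly_supported_variation X \<epsilon> K H \<longrightarrow>
        (\<exists>v\<ge>0. has_second_variation H K v))"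

end

theory Submission
  imports Defs "HOL-Complex_Analysis.Cauchy_Integral_Formula"
begin

text \<open>
  The graph of an entire function is calibrated by the Kaehler form \<open>\<omega>\<close> of \<open>\<complex>\<^sup>2\<close>: by Wirtinger's
  inequality the area density of any map dominates \<open>\<omega>(F\<^sub>x, F\<^sub>y)\<close>, with equality for a holomorphic
  graph, and the integral of \<open>\<omega>(F\<^sub>x, F\<^sub>y)\<close> is unchanged by compactly supported variations. Hence
  the area is minimal at \<open>t = 0\<close>; being twice differentiable there, it has vanishing first and
  nonnegative second derivative.

  For the growth, \<open>\<bar>sin w\<bar>\<close> is bounded on strips \<open>\<bar>Im w\<bar> \<le> M\<close>. On the box
  \<open>L \<le> Re z \<le> L + 1\<close>, \<open>e\<^sup>-\<^sup>L \<le> Im z \<le> 2e\<^sup>-\<^sup>L\<close> with \<open>L = r/2\<close> the imaginary part of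
  \<open>w = e\<^sup>z\<close> stays between two positive constants, so \<open>f\<close> is bounded while \<open>\<bar>f'\<bar>\<^sup>2\<close> is at least of
  order \<open>e\<^sup>2\<^sup>L\<close>. As the box has Euclidean area \<open>e\<^sup>-\<^sup>L\<close>, its image contributes area of order \<open>e\<^sup>L\<close>.
\<close>

section \<open>Calculus of smooth maps\<close>

text \<open>The point comes last, so that \<open>dir_deriv F v\<close> is itself a map: it can be
  differentiated again, and it is the term that occurs in the recursion of
  \<open>C_k_on\<close>.\<close>

abbreviation dir_deriv ::
  "('a::euclidean_space \<Rightarrow> 'b::euclidean_space) \<Rightarrow> 'a \<Rightarrow> 'a \<Rightarrow> 'b" where
  "dir_deriv F v x \<equiv> frechet_derivative F (at x) v"

lemma frechet_derivativeI:
  assumes "(F has_derivative F') (at x)"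
  shows "frechet_derivative F (at x) = F'"
  using frechet_derivative_at[OF assms] by simp

lemma has_derivative_frechet:
  assumes "F differentiable at x"
  shows "(F has_derivative frechet_derivative F (at x)) (at x)"
  using assms frechet_derivative_works by blast

lemma C_k_on_SucI:
  assumes "\<And>x. x \<in> S \<Longrightarrow> F differentiable at x" "\<And>v. C_k_on k (dir_deriv F v) S"
  shows "C_k_on (Suc k) F S"
  using assms by simp

section \<open>Closure properties of the classes C^k\<close>

text \<open>As \<open>S\<close> is open, the two maps agree near each of its points, hence so do
  their unrestricted derivatives. The rules for sums, linear images and inner products use this to
  replace a derivative by its formula.\<close>

lemma C_k_on_cong:
  assumes "open S" "\<And>x. x \<in> S \<Longrightarrow> F x = G x" "C_k_on k F S"
  shows "C_k_on k G S"
  using assms(2,3)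
proof (induction k arbitrary: F G)
  case 0
  then show ?case using continuous_on_cong[of S S F G] by simp
next
  case (Suc k)
  have D: "(G has_derivative frechet_derivative F (at x)) (at x)" if "x \<in> S" for x
    using Suc.prems that \<open>open S\<close>
    by (auto intro: has_derivative_transform_within_open[OF has_derivative_frechet])
  show ?case
  proof (rule C_k_on_SucI)
    show "G differentiable at x" if "x \<in> S" for x
      using D[OF that] by (rule differentiableI)
    show "C_k_on k (dir_deriv G v) S" for v
    proof (rule Suc.IH)
      show "C_k_on k (dir_deriv F v) S" using Suc.prems by simp
      show "dir_deriv F v x = dir_deriv G v x" if "x \<in> S" for x
        using frechet_derivativeI[OF D[OF that]] by simp
    qed
  qed
qed

lemma C_k_on_imp_continuous_on:
  assumes "C_k_on k F S"
  shows "continuous_on S F"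
  using assms
  by (cases k) (auto intro!: continuous_at_imp_continuous_on differentiable_imp_continuous_within)

lemma C_k_on_Suc_imp:
  assumes "C_k_on (Suc k) F S"
  shows "C_k_on k F S"
  using assms
proof (induction k arbitrary: F)
  case 0
  then show ?case using C_k_on_imp_continuous_on by fastforce
next
  case (Suc k)
  then show ?case by (meson C_k_on.simps(2))
qed

lemma C_k_on_add:
  assumes "open S" "C_k_on k F S" "C_k_on k G S"
  shows "C_k_on k (\<lambda>x. F x + G x) S"
  using assms(2,3)
proof (induction k arbitrary: F G)
  case 0
  then show ?case by (auto intro: continuous_intros)
next
  case (Suc k)
  have D: "((\<lambda>x. F x + G x) has_derivative (\<lambda>v. dir_deriv F v x + dir_deriv G v x)) (at x)"
    if "x \<in> S" for x
    using Suc.prems that by (auto intro!: has_derivative_add has_derivative_frechet)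
  show ?case
  proof (rule C_k_on_SucI)
    show "(\<lambda>x. F x + G x) differentiable at x" if "x \<in> S" for x
      using D[OF that] by (rule differentiableI)
    show "C_k_on k (dir_deriv (\<lambda>x. F x + G x) v) S" for v
    proof (rule C_k_on_cong[OF \<open>open S\<close>])
      show "C_k_on k (\<lambda>x. dir_deriv F v x + dir_deriv G v x) S"
        using Suc by simp
    qed (simp add: frechet_derivativeI[OF D])
  qed
qed

lemma C_k_on_linear:
  assumes "open S" "bounded_linear L" "C_k_on k F S"
  shows "C_k_on k (\<lambda>x. L (F x)) S"
  using assms(3)
proof (induction k arbitrary: F)
  case 0
  then show ?case
    by (auto intro: bounded_linear.continuous_on[OF \<open>bounded_linear L\<close>])
next
  case (Suc k)
  have D: "((\<lambda>x. L (F x)) has_derivative (\<lambda>v. L (dir_deriv F v x))) (at x)" if "x \<in> S" for x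
    using Suc.prems that
    by (auto intro!: bounded_linear.has_derivative[OF \<open>bounded_linear L\<close>] has_derivative_frechet)
  show ?case
  proof (rule C_k_on_SucI)
    show "(\<lambda>x. L (F x)) differentiable at x" if "x \<in> S" for x
      using D[OF that] by (rule differentiableI)
    show "C_k_on k (dir_deriv (\<lambda>x. L (F x)) v) S" for v
    proof (rule C_k_on_cong[OF \<open>open S\<close>])
      show "C_k_on k (\<lambda>x. L (dir_deriv F v x)) S"
        using Suc by simp
    qed (simp add: frechet_derivativeI[OF D])
  qed
qed

lemma C_k_on_diff:
  assumes "open S" "C_k_on k F S" "C_k_on k G S"
  shows "C_k_on k (\<lambda>x. F x - G x) S"
  using C_k_on_add[OF assms(1,2) C_k_on_linear[OF assms(1) _ assms(3), of uminus]]
  by (simp add: bounded_linear_minus[OF bounded_linear_ident])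

lemma C_k_on_inner:
  assumes "open S" "C_k_on k F S" "C_k_on k G S"
  shows "C_k_on k (\<lambda>x. F x \<bullet> G x) S"
  using assms(2,3)
proof (induction k arbitrary: F G)
  case 0
  then show ?case by (auto intro: continuous_intros)
next
  case (Suc k)
  have D: "((\<lambda>x. F x \<bullet> G x) has_derivative (\<lambda>v. F x \<bullet> dir_deriv G v x + dir_deriv F v x \<bullet> G x)) (at x)"
    if "x \<in> S" for x
    using Suc.prems that by (auto intro!: has_derivative_inner has_derivative_frechet)
  show ?case
  proof (rule C_k_on_SucI)
    show "(\<lambda>x. F x \<bullet> G x) differentiable at x" if "x \<in> S" for x
      using D[OF that] by (rule differentiableI)
    show "C_k_on k (dir_deriv (\<lambda>x. F x \<bullet> G x) v) S" for v
    proof (rule C_k_on_cong[OF \<open>open S\<close>])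
      show "C_k_on k (\<lambda>x. F x \<bullet> dir_deriv G v x + dir_deriv F v x \<bullet> G x) S"
        \<comment> \<open>The product rule leaves one factor undifferentiated; its order is lowered
          from \<open>Suc k\<close> to \<open>k\<close> so that the induction hypothesis
          applies.\<close>
        using Suc.prems Suc.prems[THEN C_k_on_Suc_imp]
        by (intro C_k_on_add[OF \<open>open S\<close>] Suc.IH) simp_all
    qed (simp add: frechet_derivativeI[OF D])
  qed
qed

lemma smooth_on_dir_deriv:
  assumes "smooth_on S F"
  shows "smooth_on S (dir_deriv F v)"
  using assms unfolding smooth_on_def by (metis C_k_on.simps(2))

lemma smooth_on_imp_differentiable:
  assumes "smooth_on S F" "x \<in> S"
  shows "F differentiable at x"
  using assms unfolding smooth_on_def by (metis C_k_on.simps(2))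

lemma smooth_on_imp_continuous_on:
  assumes "smooth_on S F"
  shows "continuous_on S F"
  using assms C_k_on_imp_continuous_on unfolding smooth_on_def by blast

lemmas smooth_on_has_derivative = has_derivative_frechet[OF smooth_on_imp_differentiable]

lemma smooth_on_add:
  assumes "open S" "smooth_on S F" "smooth_on S G"
  shows "smooth_on S (\<lambda>x. F x + G x)"
  using assms unfolding smooth_on_def by (simp add: C_k_on_add)

lemma smooth_on_diff:
  assumes "open S" "smooth_on S F" "smooth_on S G"
  shows "smooth_on S (\<lambda>x. F x - G x)"
  using assms unfolding smooth_on_def by (simp add: C_k_on_diff)

lemma smooth_on_inner:
  assumes "open S" "smooth_on S F" "smooth_on S G"
  shows "smooth_on S (\<lambda>x. F x \<bullet> G x)"
  using assms unfolding smooth_on_def by (simp add: C_k_on_inner)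

lemma smooth_on_mult:
  fixes F G :: "'a::euclidean_space \<Rightarrow> real"
  assumes "open S" "smooth_on S F" "smooth_on S G"
  shows "smooth_on S (\<lambda>x. F x * G x)"
  using smooth_on_inner[OF assms] by simp

lemma smooth_on_linear:
  assumes "open S" "bounded_linear L" "smooth_on S F"
  shows "smooth_on S (\<lambda>x. L (F x))"
  using assms unfolding smooth_on_def by (simp add: C_k_on_linear)

section \<open>Mixed derivatives and integrals of directional derivatives\<close>

lemma has_vector_derivative_along_line:
  assumes "G differentiable at (p + s *\<^sub>R v)"
  shows "((\<lambda>s. G (p + s *\<^sub>R v)) has_vector_derivative dir_deriv G v (p + s *\<^sub>R v)) (at s)"
proof -
  have "((\<lambda>s. p + s *\<^sub>R v) has_derivative (\<lambda>h. h *\<^sub>R v)) (at s)"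
    by (auto intro!: derivative_eq_intros)
  from has_derivative_compose[OF this has_derivative_frechet[OF assms]]
  have "((\<lambda>s. G (p + s *\<^sub>R v)) has_derivative
      (\<lambda>h. frechet_derivative G (at (p + s *\<^sub>R v)) (h *\<^sub>R v))) (at s)" .
  then show ?thesis
    using linear_scale[OF has_derivative_linear[OF has_derivative_frechet[OF assms]]]
    by (simp add: has_vector_derivative_def)
qed

text \<open>
  Write \<open>F\<close> along the first direction as the integral of its derivative, differentiate under the
  integral in the second direction, then recover the integrand by the fundamental theorem.
\<close>

lemma second_derivative_symmetric:
  fixes F :: "'a::euclidean_space \<Rightarrow> 'b::euclidean_space"
  assumes F: "smooth_on UNIV F"
  shows "dir_deriv (dir_deriv F v) w x = dir_deriv (dir_deriv F w) v x"
proof -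
  note DF = smooth_on_imp_differentiable[OF F UNIV_I]
    and DDF = smooth_on_imp_differentiable[OF smooth_on_dir_deriv[OF F] UNIV_I]
    and cDDF = smooth_on_imp_continuous_on[OF smooth_on_dir_deriv[OF smooth_on_dir_deriv[OF F]]]
  let ?p = "\<lambda>s r. x + s *\<^sub>R v + r *\<^sub>R w"
  have swap: "?p s r = (x + r *\<^sub>R w) + s *\<^sub>R v" for s r
    by (simp add: algebra_simps)
  have ds: "((\<lambda>s. F (?p s r)) has_vector_derivative dir_deriv F v (?p s r)) (at s)" for s r
    unfolding swap by (rule has_vector_derivative_along_line[OF DF])
  have dsdr: "((\<lambda>r. dir_deriv F v (?p s r)) has_vector_derivative dir_deriv (dir_deriv F v) w (?p s r)) (at r)"
    for s r
    by (rule has_vector_derivative_along_line[OF DDF])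
  have *: "dir_deriv F w (x + s *\<^sub>R v) = dir_deriv F w (x - v)
      + integral {-1..s} (\<lambda>\<sigma>. dir_deriv (dir_deriv F v) w (x + \<sigma> *\<^sub>R v))" if "-1 \<le> s" for s
  \<comment> \<open>The integrals start at -1 so that \<open>s = 0\<close> is an interior point,
    where the two-sided derivative in \<open>s\<close> can be taken at the end.\<close>
  proof -
    have ftc: "F (?p s r) = F (?p (-1) r) + integral {-1..s} (\<lambda>\<sigma>. dir_deriv F v (?p \<sigma> r))" for r
    proof -
      have "((\<lambda>\<sigma>. dir_deriv F v (?p \<sigma> r)) has_integral F (?p s r) - F (?p (-1) r)) {-1..s}"
        by (rule fundamental_theorem_of_calculus[OF that])
          (blast intro: has_vector_derivative_at_within[OF ds])
      then show ?thesis by (simp add: integral_unique)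
    qed
    have "((\<lambda>r. integral (cbox (-1) s) (\<lambda>\<sigma>. dir_deriv F v (?p \<sigma> r))) has_vector_derivative
        integral (cbox (-1) s) (\<lambda>\<sigma>. dir_deriv (dir_deriv F v) w (?p \<sigma> 0))) (at 0 within UNIV)"
    proof (rule leibniz_rule_vector_derivative[where fx = "\<lambda>r \<sigma>. dir_deriv (dir_deriv F v) w (?p \<sigma> r)"])
      show "(\<lambda>\<sigma>. dir_deriv F v (?p \<sigma> r)) integrable_on cbox (-1) s" for r
        by (intro integrable_continuous continuous_on_compose2[OF
              smooth_on_imp_continuous_on[OF smooth_on_dir_deriv[OF F]]] continuous_intros) auto
      show "continuous_on (UNIV \<times> cbox (-1) s) (\<lambda>(r, \<sigma>). dir_deriv (dir_deriv F v) w (?p \<sigma> r))"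
        unfolding case_prod_beta
        by (intro continuous_on_compose2[OF cDDF] continuous_intros) auto
    qed (use dsdr in auto)
    then have "((\<lambda>r. F (?p (-1) r) + integral {-1..s} (\<lambda>\<sigma>. dir_deriv F v (?p \<sigma> r)))
        has_vector_derivative (dir_deriv F w (x - v) + integral {-1..s} (\<lambda>\<sigma>. dir_deriv (dir_deriv F v) w (?p \<sigma> 0))))
        (at 0)"
      using has_vector_derivative_along_line[OF DF, where p = "x - v" and s = 0 and v = w]
      by (intro has_vector_derivative_add) auto
    then have "((\<lambda>r. F (?p s r)) has_vector_derivative
        (dir_deriv F w (x - v) + integral {-1..s} (\<lambda>\<sigma>. dir_deriv (dir_deriv F v) w (?p \<sigma> 0)))) (at 0)"
      by (simp only: ftc)
    from vector_derivative_unique_at[OF this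
        has_vector_derivative_along_line[OF DF, where p = "x + s *\<^sub>R v" and s = 0 and v = w]]
    show ?thesis by (simp only: scaleR_zero_left add_0_right)
  qed
  have 1: "((\<lambda>s. dir_deriv F w (x + s *\<^sub>R v)) has_vector_derivative dir_deriv (dir_deriv F w) v x) (at 0)"
    using has_vector_derivative_along_line[where G = "dir_deriv F w" and p = x and s = 0 and v = v] DDF
    by simp
  have "continuous_on {-1..1} (\<lambda>\<sigma>. dir_deriv (dir_deriv F v) w (x + \<sigma> *\<^sub>R v))"
    by (intro continuous_on_compose2[OF cDDF] continuous_intros) auto
  from integral_has_vector_derivative[OF this, of 0]
  have "((\<lambda>s. integral {-1..s} (\<lambda>\<sigma>. dir_deriv (dir_deriv F v) w (x + \<sigma> *\<^sub>R v)))
      has_vector_derivative dir_deriv (dir_deriv F v) w x) (at 0)"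
    by (simp add: at_within_Icc_at)
  then have "((\<lambda>s. dir_deriv F w (x - v) + integral {-1..s} (\<lambda>\<sigma>. dir_deriv (dir_deriv F v) w (x + \<sigma> *\<^sub>R v)))
      has_vector_derivative dir_deriv (dir_deriv F v) w x) (at 0)"
    using has_vector_derivative_add[OF has_vector_derivative_const] by fastforce
  then have "((\<lambda>s. dir_deriv F w (x + s *\<^sub>R v)) has_vector_derivative dir_deriv (dir_deriv F v) w x) (at 0)"
  proof (rule has_vector_derivative_transform_within_open[where S = "{-1<..}"])
    show "dir_deriv F w (x - v) + integral {-1..s} (\<lambda>\<sigma>. dir_deriv (dir_deriv F v) w (x + \<sigma> *\<^sub>R v))
        = dir_deriv F w (x + s *\<^sub>R v)" if "s \<in> {-1<..}" for s
      using *[of s] that by simp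
  qed simp_all
  from vector_derivative_unique_at[OF this 1] show ?thesis .
qed

text \<open>Differentiate the translation-invariant integral of \<open>\<phi> (z + s v)\<close> in \<open>s\<close>.\<close>

lemma has_integral_dir_deriv_zero:
  fixes \<phi> :: "'a::euclidean_space \<Rightarrow> real"
  assumes \<phi>: "smooth_on UNIV \<phi>" and K: "compact K" and supp: "\<And>z. z \<notin> K \<Longrightarrow> \<phi> z = 0"
  shows "(dir_deriv \<phi> v has_integral 0) UNIV"
proof -
  obtain a where a: "K \<subseteq> cbox (-a) a"
    using compact_imp_bounded[OF K] bounded_subset_cbox_symmetric by blast
  \<comment> \<open>A single box has to contain all translates of \<open>cbox (-a) a\<close> for
    \<open>s\<close> between -1 and 1, so that the domain of integration stays fixed while
    \<open>s\<close> varies.\<close>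
  have "bounded (\<Union>z\<in>cbox (-a) a. \<Union>s\<in>{-1..1}. {z - s *\<^sub>R v})"
  proof -
    have "compact ((\<lambda>(z, s). z - s *\<^sub>R v) ` (cbox (-a) a \<times> {-1..1::real}))"
      by (intro compact_continuous_image compact_Times compact_cbox compact_Icc)
        (auto simp: case_prod_beta intro!: continuous_intros)
    then show ?thesis
      by (rule bounded_subset[OF compact_imp_bounded]) force
  qed
  then obtain b where b: "(\<Union>z\<in>cbox (-a) a. \<Union>s\<in>{-1..1}. {z - s *\<^sub>R v}) \<subseteq> cbox (-b) b"
    using bounded_subset_cbox_symmetric by blast
  have shift: "cbox (-a - s *\<^sub>R v) (a - s *\<^sub>R v) \<subseteq> cbox (-b) b" if "s \<in> {-1..1}" for s
  proof
    fix y assume "y \<in> cbox (-a - s *\<^sub>R v) (a - s *\<^sub>R v)"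
    then have "y + s *\<^sub>R v \<in> cbox (-a) a"
      by (auto simp: mem_box algebra_simps)
    then have "(y + s *\<^sub>R v) - s *\<^sub>R v \<in> cbox (-b) b" using b that by blast
    then show "y \<in> cbox (-b) b" by simp
  qed
  have cont: "continuous_on UNIV \<phi>" by (rule smooth_on_imp_continuous_on[OF \<phi>])
  have const: "integral (cbox (-b) b) (\<lambda>z. \<phi> (z + s *\<^sub>R v)) = integral (cbox (-a) a) \<phi>"
    if s: "s \<in> {-1..1}" for s
  proof (rule integral_unique)
    have "(\<phi> has_integral integral (cbox (-a) a) \<phi>) (cbox (-a) a)"
      by (intro integrable_integral integrable_continuous continuous_on_subset[OF cont]) auto
    from has_integral_affinity'[OF this, of 1 "s *\<^sub>R v"]
    have "((\<lambda>z. \<phi> (z + s *\<^sub>R v)) has_integral integral (cbox (-a) a) \<phi>)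
        (cbox (-a - s *\<^sub>R v) (a - s *\<^sub>R v))" by simp
    then show "((\<lambda>z. \<phi> (z + s *\<^sub>R v)) has_integral integral (cbox (-a) a) \<phi>) (cbox (-b) b)"
    proof (rule has_integral_on_superset[OF _ _ shift[OF s]])
      fix z assume "z \<notin> cbox (-a - s *\<^sub>R v) (a - s *\<^sub>R v)"
      then have "z + s *\<^sub>R v \<notin> cbox (-a) a"
        by (auto simp: mem_box algebra_simps)
      then show "\<phi> (z + s *\<^sub>R v) = 0" using a supp by blast
    qed
  qed
  have "((\<lambda>s. integral (cbox (-b) b) (\<lambda>z. \<phi> (z + s *\<^sub>R v))) has_vector_derivative
      integral (cbox (-b) b) (\<lambda>z. dir_deriv \<phi> v (z + 0 *\<^sub>R v))) (at 0 within UNIV)"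
  proof (rule leibniz_rule_vector_derivative[where fx = "\<lambda>s z. dir_deriv \<phi> v (z + s *\<^sub>R v)"])
    show "((\<lambda>s. \<phi> (z + s *\<^sub>R v)) has_vector_derivative dir_deriv \<phi> v (z + s *\<^sub>R v)) (at s within UNIV)" for z s
      using has_vector_derivative_along_line[OF smooth_on_imp_differentiable[OF \<phi> UNIV_I]] by simp
    show "(\<lambda>z. \<phi> (z + s *\<^sub>R v)) integrable_on cbox (-b) b" for s
      by (intro integrable_continuous continuous_on_compose2[OF cont] continuous_intros) auto
    show "continuous_on (UNIV \<times> cbox (-b) b) (\<lambda>(s, z). dir_deriv \<phi> v (z + s *\<^sub>R v))"
      unfolding case_prod_beta
      by (intro continuous_on_compose2[OF smooth_on_imp_continuous_on[OF smooth_on_dir_deriv[OF \<phi>]]]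
          continuous_intros) auto
  qed auto
  then have "((\<lambda>s. integral (cbox (-b) b) (\<lambda>z. \<phi> (z + s *\<^sub>R v))) has_vector_derivative
      integral (cbox (-b) b) (dir_deriv \<phi> v)) (at 0)" by simp
  \<comment> \<open>By translation invariance the integral is constant for \<open>s\<close> near 0;
    the derivative found under the integral sign must therefore be 0.\<close>
  moreover have "((\<lambda>s. integral (cbox (-b) b) (\<lambda>z. \<phi> (z + s *\<^sub>R v))) has_vector_derivative 0) (at 0)"
    by (rule has_vector_derivative_transform_within_open[where S = "{-1<..<1}",
          OF has_vector_derivative_const[of "integral (cbox (-a) a) \<phi>"]]) (auto simp: const)
  ultimately have "integral (cbox (-b) b) (dir_deriv \<phi> v) = 0"
    using vector_derivative_unique_at by blast
  moreover have "dir_deriv \<phi> v integrable_on cbox (-b) b"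
    by (intro integrable_continuous continuous_on_subset[OF
          smooth_on_imp_continuous_on[OF smooth_on_dir_deriv[OF \<phi>]]]) auto
  ultimately have "(dir_deriv \<phi> v has_integral 0) (cbox (-b) b)"
    by (metis integrable_integral)
  then show ?thesis
  proof (rule has_integral_on_superset)
    fix z assume "z \<notin> cbox (-b) b"
    then have "z \<notin> K" using shift[of 0] a by auto
    \<comment> \<open>The complement of \<open>K\<close> is open, so \<open>\<phi>\<close> vanishes
      in a whole neighbourhood of \<open>z\<close>.\<close>
    have "(\<phi> has_derivative (\<lambda>_. 0)) (at z)"
      by (rule has_derivative_transform_within_open[OF has_derivative_const, of "- K"])
        (use \<open>z \<notin> K\<close> supp compact_imp_closed[OF K] in auto)
    then show "dir_deriv \<phi> v z = 0" by (simp add: frechet_derivativeI)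
  qed auto
qed

section \<open>Variations of the area and the calibration\<close>

lemma has_derivative_slice:
  fixes h :: "real \<times> 'a::euclidean_space \<Rightarrow> 'b::euclidean_space"
  assumes "h differentiable at (t, z)"
  shows "((\<lambda>z. h (t, z)) has_derivative (\<lambda>v. dir_deriv h (0, v) (t, z))) (at z)"
proof -
  have "((\<lambda>z. (t, z)) has_derivative (\<lambda>v. (0, v))) (at z)"
    by (auto intro!: derivative_eq_intros)
  from has_derivative_compose[OF this has_derivative_frechet[OF assms]] show ?thesis .
qed

text \<open>Derivatives in \<open>z\<close> at fixed \<open>t\<close> are derivatives of
  \<open>h\<close> in the directions \<open>(0, v)\<close>, so the induction stays among directional
  derivatives of the joint map.\<close>

lemma C_k_on_slice:
  fixes h :: "real \<times> 'a::euclidean_space \<Rightarrow> 'b::euclidean_space"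
  assumes "C_k_on k h (T \<times> UNIV)" "t \<in> T"
  shows "C_k_on k (\<lambda>z. h (t, z)) UNIV"
  using assms(1)
proof (induction k arbitrary: h)
  case 0
  then have "continuous_on (T \<times> UNIV) h" by simp
  then show ?case
    unfolding C_k_on.simps
    by (rule continuous_on_compose2) (use \<open>t \<in> T\<close> in \<open>auto intro!: continuous_intros\<close>)
next
  case (Suc k)
  have D: "((\<lambda>z. h (t, z)) has_derivative (\<lambda>v. dir_deriv h (0, v) (t, z))) (at z)" for z
    using Suc.prems \<open>t \<in> T\<close> by (intro has_derivative_slice) auto
  show ?case
  proof (rule C_k_on_SucI)
    show "(\<lambda>z. h (t, z)) differentiable at z" for z
      using D by (rule differentiableI)
    show "C_k_on k (dir_deriv (\<lambda>z. h (t, z)) v) UNIV" for v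
      using Suc.IH[of "dir_deriv h (0, v)"] Suc.prems by (simp add: frechet_derivativeI[OF D])
  qed
qed

lemma smooth_on_slice:
  fixes h :: "real \<times> 'a::euclidean_space \<Rightarrow> 'b::euclidean_space"
  assumes "smooth_on (T \<times> UNIV) h" "t \<in> T"
  shows "smooth_on UNIV (\<lambda>z. h (t, z))"
    and "dir_deriv (\<lambda>z. h (t, z)) v z = dir_deriv h (0, v) (t, z)"
proof -
  show "smooth_on UNIV (\<lambda>z. h (t, z))"
    using assms(1) C_k_on_slice[OF _ assms(2)] unfolding smooth_on_def by auto
  have "h differentiable at (t, z)"
    using smooth_on_imp_differentiable[OF assms(1)] assms(2) by simp
  then show "dir_deriv (\<lambda>z. h (t, z)) v z = dir_deriv h (0, v) (t, z)"
    by (simp add: frechet_derivativeI[OF has_derivative_slice])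
qed

lemma has_real_derivative_time:
  fixes h :: "real \<times> 'a::euclidean_space \<Rightarrow> real"
  assumes "h differentiable at (t, z)"
  shows "((\<lambda>t. h (t, z)) has_real_derivative dir_deriv h (1, 0) (t, z)) (at t)"
proof -
  have "((\<lambda>t. h ((0, z) + t *\<^sub>R (1, 0))) has_vector_derivative dir_deriv h (1, 0) ((0, z) + t *\<^sub>R (1, 0))) (at t)"
    by (rule has_vector_derivative_along_line) (simp add: assms)
  then show ?thesis
    unfolding has_real_derivative_iff_has_vector_derivative by simp
qed

text \<open>For the Gram determinant \<open>P\<close> of a variation the integral is an area.
  Positivity at \<open>t = 0\<close> persists over the compact box for small \<open>t\<close>; there
  the root is smooth in \<open>t\<close> and can be differentiated twice under the integral.\<close>

lemma second_derivative_integral_sqrt: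
  fixes P :: "real \<times> 'a::euclidean_space \<Rightarrow> real"
  assumes P: "smooth_on ({-\<epsilon><..<\<epsilon>} \<times> UNIV) P" and "0 < \<epsilon>"
    and pos: "\<And>z. 0 < P (0, z)"
  obtains A' v where
    "\<forall>\<^sub>F t in nhds 0.
      ((\<lambda>t. integral (cbox a b) (\<lambda>z. sqrt (P (t, z)))) has_real_derivative A' t) (at t)"
    "(A' has_real_derivative v) (at 0)"
proof -
  let ?U = "{-\<epsilon><..<\<epsilon>} \<times> (UNIV :: 'a set)"
  define P1 where "P1 = dir_deriv P (1, 0)"
  define P2 where "P2 = dir_deriv P1 (1, 0)"
  have sP1: "smooth_on ?U P1" unfolding P1_def by (rule smooth_on_dir_deriv[OF P])
  have sP2: "smooth_on ?U P2" unfolding P2_def by (rule smooth_on_dir_deriv[OF sP1])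
  have oU: "open ?U" by (simp add: open_Times)
  let ?W = "?U \<inter> P -` {0<..}"
  have "open ?W"
    by (rule continuous_open_preimage[OF smooth_on_imp_continuous_on[OF P] oU open_greaterThan])
  moreover have "{0} \<times> cbox a b \<subseteq> ?W" using pos \<open>0 < \<epsilon>\<close> by auto
  \<comment> \<open>Compactness of the box gives one time interval on which \<open>P\<close> is
    positive over all of it.\<close>
  ultimately have "\<exists>T. 0 \<in> T \<and> open T \<and> T \<times> cbox a b \<subseteq> ?W"
    by (rule Elementary_Topology.tube_lemma[OF compact_cbox])
  then obtain T where T: "0 \<in> T" "open T" "T \<times> cbox a b \<subseteq> ?W"
    by blast
  obtain \<delta> where \<delta>: "0 < \<delta>" "ball 0 \<delta> \<subseteq> T"
    using T open_contains_ball by blast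
  let ?V = "{-\<delta><..<\<delta>}"
  have V: "(t, z) \<in> ?U" "0 < P (t, z)" if "t \<in> ?V" "z \<in> cbox a b" for t z
  proof -
    have "t \<in> T" using that \<delta> by (auto simp: dist_real_def)
    then show "(t, z) \<in> ?U" "0 < P (t, z)" using T that by auto
  qed
  have dP: "((\<lambda>t. P (t, z)) has_real_derivative P1 (t, z)) (at t)" if "t \<in> ?V" "z \<in> cbox a b" for t z
    unfolding P1_def by (intro has_real_derivative_time smooth_on_imp_differentiable[OF P] V that)
  have dP1: "((\<lambda>t. P1 (t, z)) has_real_derivative P2 (t, z)) (at t)" if "t \<in> ?V" "z \<in> cbox a b" for t z
    unfolding P2_def by (intro has_real_derivative_time smooth_on_imp_differentiable[OF sP1] V that)
  have cont: "continuous_on (?V \<times> cbox a b) P" "continuous_on (?V \<times> cbox a b) P1"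
    "continuous_on (?V \<times> cbox a b) P2"
    using V by (auto intro!: continuous_on_subset[OF smooth_on_imp_continuous_on[OF P]]
        continuous_on_subset[OF smooth_on_imp_continuous_on[OF sP1]]
        continuous_on_subset[OF smooth_on_imp_continuous_on[OF sP2]])
  have slice: "continuous_on (cbox a b) (\<lambda>z. F (t, z))"
    if "t \<in> ?V" "continuous_on (?V \<times> cbox a b) F" for t and F :: "real \<times> 'a \<Rightarrow> real"
    using that by (intro continuous_on_compose2[OF that(2)] continuous_intros) auto
  have cf0: "continuous_on (?V \<times> cbox a b) (\<lambda>p. sqrt (P p))"
    by (rule continuous_on_real_sqrt[OF cont(1)])
  have pos': "P p \<noteq> 0" "2 * sqrt (P p) \<noteq> 0" "4 * P p * sqrt (P p) \<noteq> 0"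
    if "p \<in> ?V \<times> cbox a b" for p
    using V(2)[of "fst p" "snd p"] that by (simp_all add: mem_Times_iff)
  have cf1: "continuous_on (?V \<times> cbox a b) (\<lambda>p. P1 p / (2 * sqrt (P p)))"
    by (rule continuous_on_divide[OF cont(2) continuous_on_mult_left[OF cf0]]) (use pos' in blast)
  have "continuous_on (?V \<times> cbox a b) (\<lambda>p. P2 p / (2 * sqrt (P p)))"
    by (rule continuous_on_divide[OF cont(3) continuous_on_mult_left[OF cf0]]) (use pos' in blast)
  moreover have "continuous_on (?V \<times> cbox a b) (\<lambda>p. (P1 p)\<^sup>2 / (4 * P p * sqrt (P p)))"
    by (rule continuous_on_divide[OF continuous_on_power[OF cont(2)]
          continuous_on_mult[OF continuous_on_mult_left[OF cont(1)] cf0]]) (use pos' in blast)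
  ultimately have cf2: "continuous_on (?V \<times> cbox a b)
      (\<lambda>p. P2 p / (2 * sqrt (P p)) - (P1 p)\<^sup>2 / (4 * P p * sqrt (P p)))"
    by (rule continuous_on_diff)
  have sqrtP: "((\<lambda>t. sqrt (P (t, z))) has_real_derivative P1 (t, z) / (2 * sqrt (P (t, z)))) (at t)"
    if "t \<in> ?V" "z \<in> cbox a b" for t z
    using DERIV_chain2[where f = sqrt and g = "\<lambda>t. P (t, z)" and x = t,
        OF DERIV_real_sqrt[OF V(2)[OF that]] dP[OF that]]
    by (simp add: field_simps)
  define A' where "A' t = integral (cbox a b) (\<lambda>z. P1 (t, z) / (2 * sqrt (P (t, z))))" for t
  have 1: "((\<lambda>t. integral (cbox a b) (\<lambda>z. sqrt (P (t, z)))) has_real_derivative A' t) (at t)"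
    if t: "t \<in> ?V" for t
  proof -
    have "((\<lambda>t. integral (cbox a b) (\<lambda>z. sqrt (P (t, z)))) has_real_derivative A' t) (at t within ?V)"
      unfolding A'_def
    proof (rule leibniz_rule_field_derivative[where fx = "\<lambda>t z. P1 (t, z) / (2 * sqrt (P (t, z)))"])
      show "((\<lambda>t. sqrt (P (t, z))) has_real_derivative P1 (t, z) / (2 * sqrt (P (t, z))))
          (at t within ?V)" if "t \<in> ?V" "z \<in> cbox a b" for t z
        by (rule has_field_derivative_at_within[OF sqrtP[OF that]])
      show "(\<lambda>z. sqrt (P (t, z))) integrable_on cbox a b" if "t \<in> ?V" for t
        by (rule integrable_continuous) (rule slice[OF that cf0])
      show "continuous_on (?V \<times> cbox a b) (\<lambda>(t, z). P1 (t, z) / (2 * sqrt (P (t, z))))"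
        using cf1 by (simp add: case_prod_beta)
    qed (use t in auto)
    then show ?thesis by (simp only: at_within_open[OF t open_greaterThanLessThan])
  qed
  have 2: "(A' has_real_derivative integral (cbox a b)
      (\<lambda>z. P2 (0, z) / (2 * sqrt (P (0, z))) - (P1 (0, z))\<^sup>2 / (4 * P (0, z) * sqrt (P (0, z))))) (at 0)"
    (is "(_ has_real_derivative ?v) _")
  proof -
    have "(A' has_real_derivative ?v) (at 0 within ?V)"
      unfolding A'_def
    proof (rule leibniz_rule_field_derivative[where
          fx = "\<lambda>t z. P2 (t, z) / (2 * sqrt (P (t, z))) - (P1 (t, z))\<^sup>2 / (4 * P (t, z) * sqrt (P (t, z)))"])
      show "((\<lambda>t. P1 (t, z) / (2 * sqrt (P (t, z)))) has_real_derivative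
          P2 (t, z) / (2 * sqrt (P (t, z))) - (P1 (t, z))\<^sup>2 / (4 * P (t, z) * sqrt (P (t, z))))
          (at t within ?V)" if "t \<in> ?V" "z \<in> cbox a b" for t z
      proof (rule has_field_derivative_at_within)
        have p: "0 < P (t, z)" by (rule V(2)[OF that])
        show "((\<lambda>t. P1 (t, z) / (2 * sqrt (P (t, z)))) has_real_derivative
          P2 (t, z) / (2 * sqrt (P (t, z))) - (P1 (t, z))\<^sup>2 / (4 * P (t, z) * sqrt (P (t, z)))) (at t)"
        proof (rule DERIV_cong[OF DERIV_divide[OF dP1[OF that] DERIV_cmult[OF sqrtP[OF that], of 2]]])
          \<comment> \<open>With \<open>P = S * S\<close> the claim becomes an identity of rational
            functions in \<open>S\<close>.\<close>
          define S where "S = sqrt (P (t, z))"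
          have S: "S \<noteq> 0" "P (t, z) = S * S" using p by (auto simp: S_def)
          show "(P2 (t, z) * (2 * sqrt (P (t, z))) - P1 (t, z) * (2 * (P1 (t, z) / (2 * sqrt (P (t, z))))))
              / (2 * sqrt (P (t, z)) * (2 * sqrt (P (t, z))))
            = P2 (t, z) / (2 * sqrt (P (t, z))) - (P1 (t, z))\<^sup>2 / (4 * P (t, z) * sqrt (P (t, z)))"
            unfolding S_def[symmetric] S(2) using S(1) by (simp add: field_simps power2_eq_square)
        qed (use p in simp)
      qed
      show "(\<lambda>z. P1 (t, z) / (2 * sqrt (P (t, z)))) integrable_on cbox a b" if "t \<in> ?V" for t
        by (rule integrable_continuous) (rule slice[OF that cf1])
      show "continuous_on (?V \<times> cbox a b) (\<lambda>(t, z). P2 (t, z) / (2 * sqrt (P (t, z)))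
          - (P1 (t, z))\<^sup>2 / (4 * P (t, z) * sqrt (P (t, z))))"
        using cf2 by (simp add: case_prod_beta)
    qed (use \<open>0 < \<delta>\<close> in auto)
    moreover have "at 0 within ?V = at 0"
      by (rule at_within_open) (use \<open>0 < \<delta>\<close> in auto)
    ultimately show ?thesis by simp
  qed
  have "\<forall>\<^sub>F t in nhds 0. t \<in> ?V"
    using \<open>0 < \<delta>\<close> by (intro eventually_nhds_in_open) auto
  then have "\<forall>\<^sub>F t in nhds 0.
      ((\<lambda>t. integral (cbox a b) (\<lambda>z. sqrt (P (t, z)))) has_real_derivative A' t) (at t)"
    by (rule eventually_mono) (rule 1)
  then show thesis using 2 by (rule that)
qed

text \<open>The first claim is Fermat's criterion. If \<open>v\<close> were negative,
  \<open>A'\<close> would be negative just to the right of 0, and the mean value theorem would push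
  \<open>A\<close> below its minimum.\<close>

lemma derivatives_at_local_min:
  fixes A :: "real \<Rightarrow> real"
  assumes A': "\<forall>\<^sub>F t in nhds 0. (A has_real_derivative A' t) (at t)"
    and A'': "(A' has_real_derivative v) (at 0)"
    and min: "\<forall>\<^sub>F t in nhds 0. A 0 \<le> A t"
  shows "A' 0 = 0" and "0 \<le> v"
proof -
  obtain d where d: "0 < d"
    "\<And>t. \<bar>t\<bar> < d \<Longrightarrow> (A has_real_derivative A' t) (at t)" "\<And>t. \<bar>t\<bar> < d \<Longrightarrow> A 0 \<le> A t"
    using eventually_conj[OF A' min] unfolding eventually_nhds_metric
    by (auto simp: dist_real_def)
  show "A' 0 = 0"
    using DERIV_local_min[OF d(2)[of 0] \<open>0 < d\<close>] d by auto
  show "0 \<le> v"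
  proof (rule ccontr)
    assume "\<not> 0 \<le> v"
    then obtain e where e: "0 < e" "\<And>h. 0 < h \<Longrightarrow> h < e \<Longrightarrow> A' h < 0"
      using DERIV_neg_dec_right[OF A''] \<open>A' 0 = 0\<close> by auto
    define s where "s = min d e / 2"
    have s: "0 < s" "s < d" "s < e" using d(1) e(1) by (auto simp: s_def)
    have "\<exists>\<xi>>0. \<xi> < s \<and> A s - A 0 = (s - 0) * A' \<xi>"
      by (rule MVT2[OF s(1)]) (use d(2) s in auto)
    then obtain \<xi> where \<xi>: "0 < \<xi>" "\<xi> < s" "A s - A 0 = (s - 0) * A' \<xi>"
      by auto
    moreover have "A' \<xi> < 0" using e \<xi> s by auto
    ultimately have "A s < A 0" using s(1) mult_pos_neg[of s "A' \<xi>"] by simp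
    with d(3)[of s] s show False by simp
  qed
qed

section \<open>The Kaehler form as a calibration\<close>

text \<open>In real coordinates this is dx_1 wedge dy_1 + dx_2 wedge dy_2; the sign makes it
  positive on the pair \<open>a\<close>, \<open>\<i> a\<close> for nonzero \<open>a\<close>.\<close>

definition kaehler :: "complex \<times> complex \<Rightarrow> complex \<times> complex \<Rightarrow> real" where
  "kaehler a b = (\<i> * fst a, \<i> * snd a) \<bullet> b"

text \<open>Lagrange's identity: the Gram determinant exceeds the square of
  \<open>kaehler a b\<close> by the squared modulus of the complex determinant of \<open>a\<close>
  and \<open>b\<close>, which vanishes when they span a complex line.\<close>

lemma kaehler_wirtinger: "kaehler a b \<le> sqrt ((a \<bullet> a) * (b \<bullet> b) - (a \<bullet> b)\<^sup>2)"
proof (rule real_le_rsqrt)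
  have "(a \<bullet> a) * (b \<bullet> b) - (a \<bullet> b)\<^sup>2 - (kaehler a b)\<^sup>2 = (cmod (fst a * snd b - snd a * fst b))\<^sup>2"
    by (simp only: kaehler_def inner_prod_def inner_complex_def cmod_power2)
      (simp add: power2_eq_square algebra_simps)
  then show "(kaehler a b)\<^sup>2 \<le> (a \<bullet> a) * (b \<bullet> b) - (a \<bullet> b)\<^sup>2"
    by (smt (verit) zero_le_power2)
qed

text \<open>
  With \<open>u = F - X\<close> and \<open>W = F + X\<close>, twice the integrand is
  \<open>\<omega>(u\<^sub>x, W\<^sub>y) + \<omega>(W\<^sub>x, u\<^sub>y)\<close>, which is the divergence of \<open>(\<omega>(u, W\<^sub>y), \<omega>(W\<^sub>x, u))\<close>.
\<close>

lemma kaehler_null_lagrangian: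
  fixes F X :: "complex \<Rightarrow> complex \<times> complex"
  assumes F: "smooth_on UNIV F" and X: "smooth_on UNIV X" and K: "compact K"
    and FX: "\<And>z. z \<notin> K \<Longrightarrow> F z = X z"
  shows "((\<lambda>z. kaehler (dir_deriv F 1 z) (dir_deriv F \<i> z) - kaehler (dir_deriv X 1 z) (dir_deriv X \<i> z))
    has_integral 0) UNIV"
proof -
  define J :: "complex \<times> complex \<Rightarrow> complex \<times> complex" where "J a = (\<i> * fst a, \<i> * snd a)" for a
  have J: "bounded_linear J"
    unfolding J_def
    by (intro bounded_linear_Pair bounded_linear_const_mult bounded_linear_fst bounded_linear_snd)
  define u where "u z = F z - X z" for z
  define W where "W z = F z + X z" for z
  have su: "smooth_on UNIV u" and sW: "smooth_on UNIV W"
    unfolding u_def W_def using F X by (simp_all add: smooth_on_diff smooth_on_add)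
  note D = smooth_on_has_derivative[OF F UNIV_I] smooth_on_has_derivative[OF X UNIV_I]
  have Du: "dir_deriv u v z = dir_deriv F v z - dir_deriv X v z" for v z
    unfolding u_def by (simp add: frechet_derivativeI[OF has_derivative_diff[OF D]])
  have DW: "dir_deriv W v z = dir_deriv F v z + dir_deriv X v z" for v z
    unfolding W_def by (simp add: frechet_derivativeI[OF has_derivative_add[OF D]])
  have prod: "((\<lambda>z. J (a z) \<bullet> b z) has_derivative
      (\<lambda>v. J (a z) \<bullet> dir_deriv b v z + J (dir_deriv a v z) \<bullet> b z)) (at z)"
    if "smooth_on UNIV a" "smooth_on UNIV b" for a b :: "complex \<Rightarrow> complex \<times> complex" and z
    using that by (intro has_derivative_inner bounded_linear.has_derivative[OF J]
        smooth_on_has_derivative) auto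
  have sprod: "smooth_on UNIV (\<lambda>z. J (a z) \<bullet> b z)"
    if "smooth_on UNIV a" "smooth_on UNIV b" for a b :: "complex \<Rightarrow> complex \<times> complex"
    using that by (intro smooth_on_inner smooth_on_linear[OF _ J]) auto
  have zero: "u z = 0" if "z \<notin> K" for z using FX[OF that] by (simp add: u_def)
  have "(dir_deriv (\<lambda>z. J (u z) \<bullet> dir_deriv W \<i> z) 1 has_integral 0) UNIV"
    by (rule has_integral_dir_deriv_zero[OF sprod[OF su smooth_on_dir_deriv[OF sW]] K])
      (simp add: zero J_def inner_prod_def)
  moreover have "(dir_deriv (\<lambda>z. J (dir_deriv W 1 z) \<bullet> u z) \<i> has_integral 0) UNIV"
    by (rule has_integral_dir_deriv_zero[OF sprod[OF smooth_on_dir_deriv[OF sW] su] K]) (simp add: zero)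
  ultimately have "((\<lambda>z. dir_deriv (\<lambda>z. J (u z) \<bullet> dir_deriv W \<i> z) 1 z + dir_deriv (\<lambda>z. J (dir_deriv W 1 z) \<bullet> u z) \<i> z)
      has_integral 0 + 0) UNIV"
    by (rule has_integral_add)
  from has_integral_mult_right[OF this, of "1/2"]
  have "((\<lambda>z. 1/2 * (dir_deriv (\<lambda>z. J (u z) \<bullet> dir_deriv W \<i> z) 1 z
      + dir_deriv (\<lambda>z. J (dir_deriv W 1 z) \<bullet> u z) \<i> z)) has_integral 0) UNIV"
    by (simp only: add_0_left mult_zero_right)
  then show ?thesis
  proof (rule has_integral_eq[rotated])
    fix z
    have anti: "J a \<bullet> b = - (J b \<bullet> a)" for a b
      by (simp add: J_def inner_prod_def inner_complex_def)
    have e1: "dir_deriv (\<lambda>z. J (u z) \<bullet> dir_deriv W \<i> z) 1 z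
        = J (u z) \<bullet> dir_deriv (dir_deriv W \<i>) 1 z + J (dir_deriv u 1 z) \<bullet> dir_deriv W \<i> z"
      by (simp add: frechet_derivativeI[OF prod[OF su smooth_on_dir_deriv[OF sW]]])
    have e2: "dir_deriv (\<lambda>z. J (dir_deriv W 1 z) \<bullet> u z) \<i> z
        = J (dir_deriv W 1 z) \<bullet> dir_deriv u \<i> z - J (u z) \<bullet> dir_deriv (dir_deriv W 1) \<i> z"
      by (simp add: frechet_derivativeI[OF prod[OF smooth_on_dir_deriv[OF sW] su]]
          anti[of "dir_deriv (dir_deriv W 1) \<i> z" "u z"])
    \<comment> \<open>Symmetry of the mixed derivatives cancels the second-order terms of
      \<open>e1\<close> and \<open>e2\<close>, which have opposite signs because \<open>J\<close> is
      skew.\<close>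
    have sym: "dir_deriv (dir_deriv W \<i>) 1 z = dir_deriv (dir_deriv W 1) \<i> z"
      by (rule second_derivative_symmetric[OF sW])
    show "1/2 * (dir_deriv (\<lambda>z. J (u z) \<bullet> dir_deriv W \<i> z) 1 z + dir_deriv (\<lambda>z. J (dir_deriv W 1 z) \<bullet> u z) \<i> z)
      = kaehler (dir_deriv F 1 z) (dir_deriv F \<i> z) - kaehler (dir_deriv X 1 z) (dir_deriv X \<i> z)"
      unfolding e1 e2 sym unfolding Du DW
      by (simp add: J_def kaehler_def inner_prod_def inner_complex_def algebra_simps)
  qed
qed

section \<open>Geometry of graphs of entire functions\<close>

text \<open>The first component is generalised from \<open>z\<close> to \<open>a * z + c\<close> to
  make the induction close: the derivative in direction \<open>v\<close> pairs the constant
  \<open>a * v\<close> with the holomorphic function \<open>deriv g z * v\<close>, again of this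
  form.\<close>

lemma C_k_on_affine_holomorphic_pair:
  assumes "g holomorphic_on UNIV"
  shows "C_k_on k (\<lambda>z::complex. (a * z + c, g z)) UNIV"
  using assms
proof (induction k arbitrary: a c g)
  case 0
  from holomorphic_on_imp_continuous_on[OF this] show ?case
    by (auto intro!: continuous_on_Pair continuous_on_add continuous_on_mult_left continuous_on_id
        continuous_on_const)
next
  case (Suc k)
  have D: "((\<lambda>z. (a * z + c, g z)) has_derivative (\<lambda>v. (a * v, deriv g z * v))) (at z)" for z
  proof (rule has_derivative_Pair)
    show "((\<lambda>z. a * z + c) has_derivative (*) a) (at z)"
      by (auto intro!: derivative_eq_intros)
    show "(g has_derivative (*) (deriv g z)) (at z)"
      using holomorphic_derivI[OF Suc.prems open_UNIV UNIV_I]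
      by (simp add: has_field_derivative_def)
  qed
  show ?case
  proof (rule C_k_on_SucI)
    show "(\<lambda>z. (a * z + c, g z)) differentiable at z" for z
      using D by (rule differentiableI)
    show "C_k_on k (dir_deriv (\<lambda>z. (a * z + c, g z)) v) UNIV" for v
      using Suc.IH[of "\<lambda>z. deriv g z * v" 0 "a * v"] holomorphic_deriv[OF Suc.prems open_UNIV]
      by (simp add: frechet_derivativeI[OF D] holomorphic_intros)
  qed
qed

lemma smooth_on_entire_graph:
  assumes "g holomorphic_on UNIV"
  shows "smooth_on UNIV (\<lambda>z::complex. (z, g z))"
  using C_k_on_affine_holomorphic_pair[OF assms, of _ 1 0] by (simp add: smooth_on_def)

lemma frechet_derivative_entire_graph:
  assumes "g holomorphic_on UNIV"
  shows "frechet_derivative (\<lambda>z. (z, g z)) (at z) = (\<lambda>v. (v, deriv g z * v))"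
proof (rule frechet_derivativeI, rule has_derivative_Pair)
  show "(g has_derivative (*) (deriv g z)) (at z)"
    using holomorphic_derivI[OF assms open_UNIV UNIV_I] by (simp add: has_field_derivative_def)
qed (rule has_derivative_ident)

text \<open>The differential is complex linear, so the two coordinate vectors are orthogonal and of
  equal length; the Gram determinant is then a perfect square.\<close>

lemma area_density_entire_graph:
  assumes "g holomorphic_on UNIV"
  shows "area_density (\<lambda>z. (z, g z)) z = 1 + (cmod (deriv g z))\<^sup>2"
proof -
  let ?D = "frechet_derivative (\<lambda>z. (z, g z)) (at z)"
  have "?D 1 \<bullet> ?D 1 = 1 + (cmod (deriv g z))\<^sup>2" "?D \<i> \<bullet> ?D \<i> = 1 + (cmod (deriv g z))\<^sup>2"
    "?D 1 \<bullet> ?D \<i> = 0"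
    by (simp_all add: frechet_derivative_entire_graph[OF assms] inner_prod_def inner_complex_def
        cmod_power2) (simp_all add: power2_eq_square)
  then show ?thesis
    by (simp add: area_density_def Let_def)
qed

text \<open>The equality case of Wirtinger's inequality: the second coordinate vector is
  \<open>\<i>\<close> times the first, so the form takes the value of the area density.\<close>

lemma kaehler_entire_graph:
  assumes "g holomorphic_on UNIV"
  shows "kaehler (dir_deriv (\<lambda>z. (z, g z)) 1 z) (dir_deriv (\<lambda>z. (z, g z)) \<i> z) = 1 + (cmod (deriv g z))\<^sup>2"
  unfolding kaehler_def frechet_derivative_entire_graph[OF assms] inner_prod_def inner_complex_def
    cmod_power2
  by (simp add: power2_eq_square)

lemma parametrizes_smooth_surface_entire_graph:
  assumes "g holomorphic_on UNIV"
  shows "parametrizes_smooth_surface (\<lambda>z. (z, g z)) {(z, g z) | z. z \<in> UNIV}"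
  unfolding parametrizes_smooth_surface_def
proof (intro conjI allI exI)
  show "smooth_on UNIV (\<lambda>z. (z, g z))" by (rule smooth_on_entire_graph[OF assms])
  show "inj (frechet_derivative (\<lambda>z. (z, g z)) (at z))" for z
    by (auto simp: frechet_derivative_entire_graph[OF assms] inj_def)
  show "homeomorphism UNIV {(z, g z) | z. z \<in> UNIV} (\<lambda>z. (z, g z)) fst"
    using holomorphic_on_imp_continuous_on[OF assms]
    by (force simp: homeomorphism_def intro!: continuous_intros)
qed

section \<open>Area along a variation\<close>

text \<open>The density is continuous and \<open>K\<close> compact, so the area over
  \<open>K\<close> is finite and \<open>enn2real\<close> does not fall back to 0. This passes from
  the nonnegative Lebesgue integral to the gauge integral, for which the Leibniz rule and
  \<open>has_integral\<close> are used.\<close>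

lemma varied_area_eq_integral:
  assumes "smooth_on UNIV (H t)" "compact K"
  shows "continuous_on UNIV (area_density (H t))"
    and "area_density (H t) integrable_on K"
    and "varied_area H K t = integral K (area_density (H t))"
proof -
  let ?d = "area_density (H t)"
  have cd: "continuous_on UNIV (dir_deriv (H t) v)" for v
    by (rule smooth_on_imp_continuous_on[OF smooth_on_dir_deriv[OF assms(1)]])
  show c: "continuous_on UNIV ?d"
    unfolding area_density_def Let_def by (intro continuous_intros cd)
  have "(\<lambda>z. indicator K z *\<^sub>R ?d z) = (\<lambda>z. if z \<in> K then ?d z else 0)"
    by auto
  with borel_integrable_compact[OF \<open>compact K\<close> continuous_on_subset[OF c subset_UNIV]]
  have "integrable lborel (\<lambda>z. if z \<in> K then ?d z else 0)"
    by simp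
  from integrable_on_lborel[OF this]
  show i: "?d integrable_on K"
    unfolding Henstock_Kurzweil_Integration.integrable_restrict_UNIV .
  have nonneg: "0 \<le> ?d z" for z
    unfolding area_density_def Let_def
    by (intro real_sqrt_ge_zero) (simp add: Cauchy_Schwarz_ineq)
  have I: "((\<lambda>z. if z \<in> K then ?d z else 0) has_integral integral K ?d) UNIV"
    using integrable_integral[OF i] by (subst has_integral_restrict_UNIV)
  have "(\<integral>\<^sup>+z\<in>K. ennreal (?d z) \<partial>lborel) = (\<integral>\<^sup>+z. ennreal (if z \<in> K then ?d z else 0) \<partial>lborel)"
    by (intro nn_integral_cong) (auto simp: indicator_def)
  also have "\<dots> = ennreal (integral K ?d)"
  proof (rule nn_integral_has_integral_lborel[OF _ _ I])
    have "?d \<in> borel_measurable borel" by (rule borel_measurable_continuous_onI[OF c])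
    then show "(\<lambda>z. if z \<in> K then ?d z else 0) \<in> borel_measurable borel"
      using compact_imp_closed[OF \<open>compact K\<close>] by (intro measurable_If_set) auto
  qed (use nonneg in auto)
  finally show "varied_area H K t = integral K ?d"
    unfolding varied_area_def area_over_def using integral_nonneg[OF i] nonneg by simp
qed

text \<open>The calibration makes \<open>t = 0\<close> a minimum of the area. Up to a constant the
  area is the integral of the root of a Gram determinant over a box, hence twice differentiable, and
  the derivative tests at a minimum give the two signs.\<close>

lemma entire_graph_variation:
  fixes g :: "complex \<Rightarrow> complex"
  defines "X \<equiv> \<lambda>z. (z, g z)"
  assumes g: "g holomorphic_on UNIV"
    and H: "compactly_supported_variation X \<epsilon> K H"
  obtains A' v where
    "\<forall>\<^sub>F t in nhds 0. (varied_area H K has_real_derivative A' t) (at t)"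
    "(A' has_real_derivative v) (at 0)" "A' 0 = 0" "0 \<le> v"
proof -
  let ?U = "{-\<epsilon><..<\<epsilon>} \<times> (UNIV :: complex set)"
  have \<epsilon>: "0 < \<epsilon>" and K: "compact K" and H0: "H 0 = X"
    and off: "\<And>t z. \<bar>t\<bar> < \<epsilon> \<Longrightarrow> z \<notin> K \<Longrightarrow> H t z = X z"
    and sH: "smooth_on ?U (\<lambda>(t, z). H t z)"
    using H unfolding compactly_supported_variation_def by auto
  define h where "h = (\<lambda>(t, z). H t z)"
  have sh: "smooth_on ?U h" using sH by (simp add: h_def)
  have slice: "smooth_on UNIV (H t)" "dir_deriv (H t) v z = dir_deriv h (0, v) (t, z)"
    if "\<bar>t\<bar> < \<epsilon>" for t v z
    using smooth_on_slice[OF sh, of t] that by (simp_all add: h_def abs_less_iff)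
  have sX: "smooth_on UNIV X" unfolding X_def by (rule smooth_on_entire_graph[OF g])
  define hx where "hx = dir_deriv h (0, 1)"
  define hy where "hy = dir_deriv h (0, \<i>)"
  \<comment> \<open>The Gram determinant as a function of time and place; the square is written as a
    product to match \<open>smooth_on_mult\<close>.\<close>
  define P where "P p = (hx p \<bullet> hx p) * (hy p \<bullet> hy p) - (hx p \<bullet> hy p) * (hx p \<bullet> hy p)" for p
  have oU: "open ?U" by (simp add: open_Times)
  have shx: "smooth_on ?U hx" and shy: "smooth_on ?U hy"
    unfolding hx_def hy_def by (rule smooth_on_dir_deriv[OF sh])+
  have sP: "smooth_on ?U P"
    unfolding P_def by (intro smooth_on_diff smooth_on_mult smooth_on_inner oU shx shy)
  have density: "area_density (H t) z = sqrt (P (t, z))" if "\<bar>t\<bar> < \<epsilon>" for t z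
    using slice(2)[OF that]
    by (simp add: area_density_def Let_def P_def hx_def hy_def power2_eq_square)
  have density_X: "area_density X z = 1 + (cmod (deriv g z))\<^sup>2" for z
    unfolding X_def by (rule area_density_entire_graph[OF g])
  have "0 < sqrt (P (0, z))" for z
    using density[of 0 z] density_X[of z] \<epsilon> H0 add_pos_nonneg[of 1 "(cmod (deriv g z))\<^sup>2"] by simp
  then have pos: "0 < P (0, z)" for z by simp
  have same: "area_density (H t) z = area_density X z" if t: "\<bar>t\<bar> < \<epsilon>" and z: "z \<notin> K" for t z
  proof -
    have "frechet_derivative (H t) (at z) = frechet_derivative X (at z)"
    proof (rule frechet_derivative_transform_within_open[of _ _ "- K"])
      show "H t differentiable at z"
        by (rule smooth_on_imp_differentiable[OF slice(1)[OF t] UNIV_I])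
    qed (use K z off[OF t] in \<open>auto simp: compact_imp_closed\<close>)
    then show ?thesis by (simp add: area_density_def)
  qed
  have VA: "continuous_on UNIV (area_density (H t))" "area_density (H t) integrable_on K"
    "varied_area H K t = integral K (area_density (H t))" if "\<bar>t\<bar> < \<epsilon>" for t
    using varied_area_eq_integral[where H = H and t = t, OF slice(1)[OF that] K] .
  obtain b where b: "K \<subseteq> cbox (-b) b"
    using compact_imp_bounded[OF K] bounded_subset_cbox_symmetric by blast
  \<comment> \<open>The densities agree off \<open>K\<close>, so any larger domain \<open>T\<close>
    gives the same difference of areas. The whole plane serves for the calibration, a box for
    differentiation in \<open>t\<close>.\<close>
  have diff: "((\<lambda>z. area_density (H t) z - area_density X z) has_integral
      varied_area H K t - varied_area H K 0) T" if t: "\<bar>t\<bar> < \<epsilon>" and T: "K \<subseteq> T" for t T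
  proof (rule has_integral_on_superset[OF _ _ T])
    show "((\<lambda>z. area_density (H t) z - area_density X z) has_integral
        varied_area H K t - varied_area H K 0) K"
      using has_integral_diff[OF integrable_integral[OF VA(2)[OF t]]
          integrable_integral[OF VA(2)[of 0]]] VA(3)[OF t] VA(3)[of 0] \<epsilon> H0 by simp
  qed (simp add: same[OF t])
  have min: "varied_area H K 0 \<le> varied_area H K t" if t: "\<bar>t\<bar> < \<epsilon>" for t
  proof -
    have "0 \<le> varied_area H K t - varied_area H K 0"
    \<comment> \<open>Pointwise, Wirtinger's inequality for \<open>H t\<close> is combined with
      equality for \<open>X\<close>; the difference of the Kaehler terms integrates to 0.\<close>
    proof (rule has_integral_le[OF _ diff[OF t subset_UNIV]])
      show "((\<lambda>z. kaehler (dir_deriv (H t) 1 z) (dir_deriv (H t) \<i> z) - kaehler (dir_deriv X 1 z) (dir_deriv X \<i> z))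
          has_integral 0) UNIV"
        by (rule kaehler_null_lagrangian[OF slice(1)[OF t] sX K off[OF t]])
      show "kaehler (dir_deriv (H t) 1 z) (dir_deriv (H t) \<i> z) - kaehler (dir_deriv X 1 z) (dir_deriv X \<i> z)
          \<le> area_density (H t) z - area_density X z" for z
        using kaehler_wirtinger[of "dir_deriv (H t) 1 z" "dir_deriv (H t) \<i> z"]
          kaehler_entire_graph[OF g, of z] density_X[of z]
        by (simp add: area_density_def[of "H t"] Let_def X_def)
    qed
    then show ?thesis by simp
  qed
  \<comment> \<open>The area of the unvaried graph over the part of the box outside
    \<open>K\<close>. Being independent of \<open>t\<close>, it allows the arbitrary compact set
    \<open>K\<close> to be traded for a box.\<close>
  define c where "c = integral (cbox (-b) b) (area_density X) - varied_area H K 0"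
  have VA_box: "varied_area H K t = integral (cbox (-b) b) (\<lambda>z. sqrt (P (t, z))) - c"
    if t: "\<bar>t\<bar> < \<epsilon>" for t
  proof -
    have int: "area_density (H s) integrable_on cbox (-b) b" if "\<bar>s\<bar> < \<epsilon>" for s
      by (intro integrable_continuous continuous_on_subset[OF VA(1)[OF that]]) simp
    have "varied_area H K t - varied_area H K 0
        = integral (cbox (-b) b) (area_density (H t)) - integral (cbox (-b) b) (area_density X)"
      using integral_unique[OF diff[OF t b]] integral_diff[OF int[OF t] int[of 0]] \<epsilon> H0 by simp
    moreover have "area_density (H t) = (\<lambda>z. sqrt (P (t, z)))"
      using density[OF t] by blast
    ultimately show ?thesis by (simp add: c_def)
  qed
  obtain A' v where A':
    "\<forall>\<^sub>F t in nhds 0.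
      ((\<lambda>t. integral (cbox (-b) b) (\<lambda>z. sqrt (P (t, z)))) has_real_derivative A' t) (at t)"
    and v: "(A' has_real_derivative v) (at 0)"
    using second_derivative_integral_sqrt[OF sP \<epsilon> pos] by blast
  have near: "\<forall>\<^sub>F t in nhds 0. t \<in> {-\<epsilon><..<\<epsilon>}"
    using \<epsilon> by (intro eventually_nhds_in_open) auto
  have A'_VA: "\<forall>\<^sub>F t in nhds 0. (varied_area H K has_real_derivative A' t) (at t)"
    using eventually_conj[OF A' near]
  proof (rule eventually_mono)
    fix t assume "((\<lambda>t. integral (cbox (-b) b) (\<lambda>z. sqrt (P (t, z)))) has_real_derivative A' t) (at t)
      \<and> t \<in> {-\<epsilon><..<\<epsilon>}"
    then have "((\<lambda>t. integral (cbox (-b) b) (\<lambda>z. sqrt (P (t, z))) - c) has_real_derivative A' t) (at t)"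
      and "t \<in> {-\<epsilon><..<\<epsilon>}"
      using DERIV_diff[OF _ DERIV_const] by fastforce+
    then show "(varied_area H K has_real_derivative A' t) (at t)"
      by (rule has_field_derivative_transform_within_open[OF _ open_greaterThanLessThan])
        (simp add: VA_box abs_less_iff)
  qed
  moreover have "\<forall>\<^sub>F t in nhds 0. varied_area H K 0 \<le> varied_area H K t"
    using near by (rule eventually_mono) (simp add: min abs_less_iff)
  ultimately show thesis
    using derivatives_at_local_min[OF A'_VA v] v that by blast
qed

theorem stable_minimal_surface_entire_graph:
  assumes g: "g holomorphic_on UNIV"
  shows "stable_minimal_surface (\<lambda>z. (z, g z)) {(z, g z) | z. z \<in> UNIV}"
  unfolding stable_minimal_surface_def minimal_surface_def
proof (intro conjI allI impI parametrizes_smooth_surface_entire_graph[OF g])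
  fix \<epsilon> K H assume "compactly_supported_variation (\<lambda>z. (z, g z)) \<epsilon> K H"
  from entire_graph_variation[OF g this] obtain A' v where A':
    "\<forall>\<^sub>F t in nhds 0. (varied_area H K has_real_derivative A' t) (at t)"
    "(A' has_real_derivative v) (at 0)" "A' 0 = 0" "0 \<le> v" .
  \<comment> \<open>A property that holds eventually in \<open>nhds 0\<close> holds at 0 itself,
    which gives the derivative \<open>A' 0\<close> there.\<close>
  then show "has_first_variation H K 0"
    unfolding has_first_variation_def using eventually_nhds_x_imp_x[OF A'(1)] by simp
  show "\<exists>v\<ge>0. has_second_variation H K v"
    unfolding has_second_variation_def using A' by blast
qed

section \<open>Area growth\<close>

text \<open>The height of the box offsets the growth of \<open>exp\<close>:
  \<open>Im (exp z)\<close> stays between 1/2 and 6. The upper bound controls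
  \<open>sin (exp z)\<close>; the lower one keeps \<open>exp z\<close> away from the real zeros of
  \<open>cos\<close>, and the factor \<open>exp z\<close> supplies the growth.\<close>

lemma sin_exp_box_bounds:
  fixes L :: real and z :: complex
  assumes L: "1 \<le> L" and z: "z \<in> cbox (Complex L (exp (- L))) (Complex (L + 1) (2 * exp (- L)))"
  shows "cmod (sin (exp z)) \<le> exp 6" and "exp (2 * L) / 4 \<le> (cmod (cos (exp z) * exp z))\<^sup>2"
proof -
  define x where "x = Re z"
  define y where "y = Im z"
  have x: "L \<le> x" "x \<le> L + 1" and y: "exp (- L) \<le> y" "y \<le> 2 * exp (- L)"
    using z by (auto simp: x_def y_def in_cbox_complex_iff)
  have "2 \<le> exp L" using L exp_ge_add_one_self[of L] by linarith
  then have y1: "y \<le> 1" "0 < y"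
    using y less_le_trans[OF exp_gt_zero y(1)] le_imp_inverse_le[of 2 "exp L"]
    by (auto simp: exp_minus)
  \<comment> \<open>For 0 < \<open>y\<close> \<le> 1 < pi/3 the slope \<open>cos \<xi>\<close> from
    the mean value theorem is at least cos(pi/3) = 1/2.\<close>
  have siny: "y / 2 \<le> sin y" "sin y \<le> y"
  proof -
    have "\<exists>\<xi>>0. \<xi> < y \<and> sin y - sin 0 = (y - 0) * cos \<xi>"
      by (rule MVT2[OF y1(2)]) simp
    then obtain \<xi> where \<xi>: "0 < \<xi>" "\<xi> < y" "sin y = y * cos \<xi>" by auto
    have "cos (pi / 3) \<le> cos \<xi>"
      using \<xi> y1 pi_gt3 by (intro cos_monotone_0_pi_le) auto
    then have "y * (1 / 2) \<le> y * cos \<xi>"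
      using y1 by (intro mult_left_mono) (auto simp: cos_60)
    then show "y / 2 \<le> sin y" using \<xi> by simp
    show "sin y \<le> y" using sin_x_le_x y1 by simp
  qed
  define s where "s = Im (exp z)"
  have s: "s = exp x * sin y" by (simp add: s_def Im_exp x_def y_def)
  have "exp L * (exp (- L) / 2) \<le> exp x * sin y"
    using x y siny by (intro mult_mono) auto
  then have s1: "1 / 2 \<le> s" by (simp add: s exp_minus)
  have "exp x * sin y \<le> exp (L + 1) * (2 * exp (- L))"
    using x y y1 siny by (intro mult_mono) auto
  also have "\<dots> = 2 * exp 1" by (simp add: exp_add exp_minus)
  also have "\<dots> \<le> 6" using exp_le by simp
  finally have s2: "s \<le> 6" by (simp add: s)
  have "(cmod (sin (exp z)))\<^sup>2 = (exp (2 * s) + inverse (exp (2 * s)) - 2 * cos (2 * Re (exp z))) / 4"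
    by (simp add: norm_sin_squared s_def)
  also have "\<dots> \<le> (exp 12 + 1 + 2) / 4"
  proof -
    have "exp (2 * s) \<le> exp 12" using s2 by simp
    moreover have "inverse (exp (2 * s)) \<le> 1" using s1 by (simp add: exp_minus[symmetric])
    moreover have "- 1 \<le> cos (2 * Re (exp z))" by simp
    moreover have "(a + i - 2 * c) / 4 \<le> (b + 1 + 2) / 4" if "a \<le> b" "i \<le> 1" "-1 \<le> c"
      for a b c i :: real
      using that by simp
    ultimately show ?thesis by blast
  qed
  also have "\<dots> \<le> exp 12" using exp_ge_add_one_self[of 12] by simp
  also have "\<dots> = (exp 6)\<^sup>2" by (simp add: power2_eq_square exp_add[symmetric])
  finally show "cmod (sin (exp z)) \<le> exp 6" by (rule power2_le_imp_le) simp
  have "1 \<le> exp s - inverse (exp s)"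
  proof -
    \<comment> \<open>The quadratic term matters: 13/8 - 8/13 = 105/104 just exceeds 1, whereas the
      linear bound 3/2 would give only 5/6.\<close>
    have "1 + 1/2 + (1/2)\<^sup>2 / 2 \<le> 1 + s + s\<^sup>2 / 2"
      using s1 by (intro add_mono divide_right_mono power_mono) auto
    also have "\<dots> \<le> exp s" using s1 by (intro exp_lower_Taylor_quadratic) simp
    finally have "13/8 \<le> exp s" by (simp add: power2_eq_square)
    moreover from this have "inverse (exp s) \<le> inverse (13/8)"
      by (intro le_imp_inverse_le) auto
    ultimately show ?thesis by simp
  qed
  then have "1 \<le> (exp s - inverse (exp s))\<^sup>2" by simp
  \<comment> \<open>The squared modulus of cos w is cos(Re w)^2 + sinh(Im w)^2, and the second
    summand is at least 1/4 here.\<close>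
  then have c: "1 / 4 \<le> (cmod (cos (exp z)))\<^sup>2"
    by (simp add: norm_cos_squared s_def add_increasing)
  have "exp (2 * L) * (1 / 4) \<le> exp (2 * x) * (cmod (cos (exp z)))\<^sup>2"
    using x by (intro mult_mono c) auto
  also have "\<dots> = (cmod (cos (exp z) * exp z))\<^sup>2"
    by (simp add: norm_mult power_mult_distrib x_def exp_double)
  finally show "exp (2 * L) / 4 \<le> (cmod (cos (exp z) * exp z))\<^sup>2" by simp
qed

lemma emeasure_cbox_complex:
  assumes "a \<le> b" "c \<le> d"
  shows "emeasure lborel (cbox (Complex a c) (Complex b d)) = ennreal ((b - a) * (d - c))"
  using assms by (subst emeasure_lborel_cbox) (auto simp: Basis_complex_def)

lemma area_over_ge:
  assumes "B \<in> sets borel" "B \<subseteq> D" "\<And>z. z \<in> B \<Longrightarrow> m \<le> area_density X z"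
  shows "ennreal m * emeasure lborel B \<le> area_over X D"
proof -
  have "ennreal m * emeasure lborel B = (\<integral>\<^sup>+z\<in>B. ennreal m \<partial>lborel)"
    using assms(1) by (simp add: nn_integral_cmult_indicator)
  also have "\<dots> \<le> area_over X D"
    unfolding area_over_def
    using assms by (intro nn_integral_mono) (auto simp: indicator_def ennreal_leI)
  finally show ?thesis .
qed

text \<open>A box of Euclidean area \<open>exp (- L)\<close> with density at least
  \<open>exp (2 * L) / 4\<close> contributes \<open>exp (r / 2) / 4\<close>; half of the exponent is
  given up to absorb the factor 1/4.\<close>

lemma area_growth_sin_exp:
  fixes X :: "complex \<Rightarrow> complex \<times> complex"
  defines "X \<equiv> \<lambda>z. (z, sin (exp z))"
  assumes r: "10 + 2 * exp 6 \<le> r"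
  shows "ennreal (exp (1/4 * r)) \<le> area_over X (X -` (ball 0 r))"
proof -
  have "(\<lambda>z. sin (exp z)) holomorphic_on (UNIV :: complex set)"
    by (intro holomorphic_intros)
  moreover have "deriv (\<lambda>z. sin (exp z)) z = cos (exp z) * exp z" for z :: complex
    by (rule DERIV_imp_deriv) (auto intro!: derivative_eq_intros)
  ultimately have density: "area_density X z = 1 + (cmod (cos (exp z) * exp z))\<^sup>2" for z
    unfolding X_def by (simp add: area_density_entire_graph)
  \<comment> \<open>The real part uses up about half of the radius; the other half leaves room for
    \<open>Im z\<close> and for the value bounded by \<open>exp 6\<close>.\<close>
  define L where "L = r / 2"
  define B where "B = cbox (Complex L (exp (- L))) (Complex (L + 1) (2 * exp (- L)))"
  have e6: "0 < exp (6::real)" by simp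
  have r10: "10 \<le> r" using r e6 by linarith
  then have L: "1 \<le> L" by (simp add: L_def)
  have "B \<subseteq> X -` (ball 0 r)"
  proof
    fix z assume z: "z \<in> B"
    have "exp (- L) \<le> 1" using L by simp
    moreover have "L \<le> Re z" "Re z \<le> L + 1" "exp (- L) \<le> Im z" "Im z \<le> 2 * exp (- L)"
      using z by (auto simp: B_def in_cbox_complex_iff)
    ultimately have "\<bar>Re z\<bar> \<le> r / 2 + 1" "\<bar>Im z\<bar> \<le> 2"
      using L exp_gt_zero[of "- L"] unfolding L_def by linarith+
    then have "cmod z \<le> r / 2 + 3" using cmod_le[of z] by linarith
    moreover have "cmod (sin (exp z)) \<le> exp 6"
      using sin_exp_box_bounds(1)[OF L] z by (simp add: B_def)
    ultimately have "norm (X z) \<le> r / 2 + 3 + exp 6"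
      unfolding X_def using norm_Pair_le[of z "sin (exp z)"] by linarith
    \<comment> \<open>This amounts to \<open>r > 6 + 2 * exp 6\<close>, which the threshold on
      \<open>r\<close> guarantees.\<close>
    also have "\<dots> < r" using r by linarith
    finally show "z \<in> X -` (ball 0 r)" by simp
  qed
  moreover have "exp (2 * L) / 4 \<le> area_density X z" if "z \<in> B" for z
    using sin_exp_box_bounds(2)[OF L] that density[of z] by (simp add: B_def add_increasing)
  moreover have "B \<in> sets borel" by (simp add: B_def)
  ultimately have "ennreal (exp (2 * L) / 4) * emeasure lborel B \<le> area_over X (X -` (ball 0 r))"
    by (intro area_over_ge)
  moreover have "emeasure lborel B = ennreal (exp (- L))"
    unfolding B_def by (subst emeasure_cbox_complex) auto
  ultimately have "ennreal (exp (2 * L) / 4 * exp (- L)) \<le> area_over X (X -` (ball 0 r))"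
    by (subst ennreal_mult) simp_all
  moreover have "exp (1/4 * r) \<le> exp (2 * L) / 4 * exp (- L)"
  proof -
    \<comment> \<open>From \<open>exp 6\<close> \<ge> 7 follows \<open>r\<close> \<ge> 24, so
      \<open>exp (r / 4)\<close> is at least 1 + 6.\<close>
    have "4 \<le> exp (r / 4) * 1"
      using r e6 exp_ge_add_one_self[of "6::real"] exp_ge_add_one_self[of "r / 4"] by linarith
    then have "4 * exp (r / 4) \<le> exp (r / 4) * exp (r / 4)" by simp
    also have "\<dots> = exp (2 * L) * exp (- L)"
      by (simp add: L_def exp_add[symmetric])
    finally show ?thesis by simp
  qed
  ultimately show ?thesis by (meson ennreal_leI order_trans)
qed

theorem theorem2p1:
  fixes f :: "complex \<Rightarrow> complex"
    and X :: "complex \<Rightarrow> complex \<times> complex"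
    and S :: "(complex \<times> complex) set"
  defines "f \<equiv> \<lambda>z. sin (exp z)"
    and "X \<equiv> \<lambda>z. (z, f z)"
    and "S \<equiv> {(z, f z) | z. z \<in> UNIV}"
  shows "stable_minimal_surface X S \<and>
    (\<exists>c>0. \<exists>r0>0. \<forall>r\<ge>r0. ennreal (exp (c * r)) \<le> area_over X (X -` (ball 0 r \<inter> S)))"
proof
  have f: "f holomorphic_on UNIV"
    unfolding f_def by (intro holomorphic_intros)
  show "stable_minimal_surface X S"
    unfolding X_def S_def by (rule stable_minimal_surface_entire_graph[OF f])
  \<comment> \<open>Every value of \<open>X\<close> lies in \<open>S\<close>, so the preimage is
    that of the ball.\<close>
  have S: "X -` (ball 0 r \<inter> S) = (\<lambda>z. (z, sin (exp z))) -` ball 0 r" for r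
    by (auto simp: X_def S_def f_def)
  have X: "X = (\<lambda>z. (z, sin (exp z)))" by (simp add: X_def f_def)
  show "\<exists>c>0. \<exists>r0>0. \<forall>r\<ge>r0. ennreal (exp (c * r)) \<le> area_over X (X -` (ball 0 r \<inter> S))"
  proof (intro exI conjI allI impI)
    show "ennreal (exp (1/4 * r)) \<le> area_over X (X -` (ball 0 r \<inter> S))"
      if "10 + 2 * exp 6 \<le> r" for r
      unfolding S unfolding X by (rule area_growth_sin_exp[OF that])
  qed (auto intro: add_pos_pos)
qed

end
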